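(* Let $\lambda_2\ge 0$ and let $(\eta^{(t)})_{t\ge 0}$ be a sequence of positive learning rates (possibly varying with $t$). Let $0\le\psi_j\le k$ be integers, and suppose that the real weight $w_j$ evolves, for every $t$ with $\psi_j\le t<k$, by the FoBoS $\ell_2^2$ regularization update $$w_j^{(t+1)}=\frac{w_j^{(t)}}{1+\eta^{(t)}\lambda_2} .$$ Let $\Phi(-1)=1$ and $\Phi(t)=(1+\eta^{(t)}\lambda_2)^{-1}\cdot\Phi(t-1)$ for $t\ge 0$, so that $\Phi(0)=\frac{1}{1+\eta^{(0)}\lambda_2}$. Then $$w_j^{(k)}=w_j^{(\psi_j)}\,\frac{\Phi(k-1)}{\Phi(\psi_j-1)} .$$ In particular, given stored values of $\Phi$, the $k-\psi_j$ successive updates can be applied with a number of arithmetic operations bounded independently of $k-\psi_j$.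
   Context: Setting: a linear model with weight vector $w\in\mathbb{R}^d$ is trained by forward backward splitting (FoBoS) with squared-norm ($\ell_2^2$) regularization. Each iteration takes a gradient step $w^{(t+\frac12)}=w^{(t)}-\eta^{(t)}\nabla L_i(w^{(t)})$ on the unregularized loss of one example, and then sets $$w^{(t+1)}=\operatorname{argmin}_{w}\left(\tfrac12\|w-w^{(t+\frac12)}\|_2^2+\tfrac12\eta^{(t)}\lambda_2\|w\|_2^2\right).$$ At time steps when the current example has feature value $x_{ij}=0$, one has $w_j^{(t+\frac12)}=w_j^{(t)}$, and the $j$-th coordinate of the minimizer is given by the update displayed in the claim. The superscript $(t)$ denotes the value at iteration $t$; $\psi_j$ is the last iteration at which the stored value of $w_j$ was current, and $k$ is the current iteration. *)

theory Defs
  imports Complex_Main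
begin

definition fobos_l2sq_update :: "real \<Rightarrow> real \<Rightarrow> real \<Rightarrow> real"
  where "fobos_l2sq_update lam2 \<eta> x = x / (1 + \<eta> * lam2)"

text \<open>The sequence \<open>w\<close> consists of the values of one fixed coordinate; the index \<open>\<psi>\<close> is the last
  iteration at which its stored value was current. Nothing is assumed about \<open>w\<close> before \<open>\<psi>\<close> or
  after \<open>k\<close>.\<close>

definition fobos_l2sq_setting ::
    "real \<Rightarrow> (nat \<Rightarrow> real) \<Rightarrow> (nat \<Rightarrow> real) \<Rightarrow> nat \<Rightarrow> nat \<Rightarrow> bool"
  where "fobos_l2sq_setting lam2 \<eta> w \<psi> k \<longleftrightarrow>
    0 \<le> lam2 \<and> (\<forall>t. 0 < \<eta> t) \<and> \<psi> \<le> k \<and>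
    (\<forall>t. \<psi> \<le> t \<and> t < k \<longrightarrow> w (t + 1) = fobos_l2sq_update lam2 (\<eta> t) (w t))"

text \<open>The argument is an integer because the recursion starts at \<open>-1\<close>; the value \<open>1\<close> below \<open>-1\<close>
  is a totalisation that is never used.\<close>

function \<Phi> :: "real \<Rightarrow> (nat \<Rightarrow> real) \<Rightarrow> int \<Rightarrow> real"
  where "\<Phi> lam2 \<eta> t =
    (if t \<le> -1 then 1 else inverse (1 + \<eta> (nat t) * lam2) * \<Phi> lam2 \<eta> (t - 1))"
  by pat_completeness auto
termination
  by (relation "measure (\<lambda>(_, _, t). nat (t + 1))") auto

declare \<Phi>.simps [simp del]

text \<open>Programs over integer registers (for iteration indices), real registers and one read-only
  table of reals indexed by integers, which holds the stored values of \<open>\<Phi>\<close>. Real literals are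
  restricted to integers. There is a bounded loop, so the cost of a fixed program may depend on its
  input. Every addition, subtraction, multiplication and division costs one unit, on indices as well
  as on reals. Table accesses and loop iterations are charged one unit each on top, so the cost is an
  upper bound for the number of arithmetic operations.\<close>

datatype iexp = IReg nat | ILit int | IAdd iexp iexp | ISub iexp iexp

datatype rexp = RReg nat | RLit int | Lookup iexp
  | RAdd rexp rexp | RSub rexp rexp | RMul rexp rexp | RDiv rexp rexp

datatype prog = ISet nat iexp | RSet nat rexp | Seq prog prog | Repeat iexp prog

type_synonym state = "(nat \<Rightarrow> int) \<times> (nat \<Rightarrow> real)"

primrec ival :: "(nat \<Rightarrow> int) \<Rightarrow> iexp \<Rightarrow> int" where
  "ival I (IReg n) = I n"
| "ival I (ILit c) = c"
| "ival I (IAdd a b) = ival I a + ival I b"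
| "ival I (ISub a b) = ival I a - ival I b"

primrec icost :: "iexp \<Rightarrow> nat" where
  "icost (IReg n) = 0"
| "icost (ILit c) = 0"
| "icost (IAdd a b) = icost a + icost b + 1"
| "icost (ISub a b) = icost a + icost b + 1"

primrec rval :: "(int \<Rightarrow> real) \<Rightarrow> state \<Rightarrow> rexp \<Rightarrow> real" where
  "rval T s (RReg n) = snd s n"
| "rval T s (RLit c) = of_int c"
| "rval T s (Lookup i) = T (ival (fst s) i)"
| "rval T s (RAdd a b) = rval T s a + rval T s b"
| "rval T s (RSub a b) = rval T s a - rval T s b"
| "rval T s (RMul a b) = rval T s a * rval T s b"
| "rval T s (RDiv a b) = rval T s a / rval T s b"

primrec rcost :: "rexp \<Rightarrow> nat" where
  "rcost (RReg n) = 0"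
| "rcost (RLit c) = 0"
| "rcost (Lookup i) = icost i + 1"
| "rcost (RAdd a b) = rcost a + rcost b + 1"
| "rcost (RSub a b) = rcost a + rcost b + 1"
| "rcost (RMul a b) = rcost a + rcost b + 1"
| "rcost (RDiv a b) = rcost a + rcost b + 1"

text \<open>The second component of the configuration accumulates the cost.\<close>

primrec exec :: "(int \<Rightarrow> real) \<Rightarrow> prog \<Rightarrow> state \<times> nat \<Rightarrow> state \<times> nat" where
  "exec T (ISet n e) c =
     (case c of ((I, R), m) \<Rightarrow> ((I(n := ival I e), R), m + icost e))"
| "exec T (RSet n e) c =
     (case c of ((I, R), m) \<Rightarrow> ((I, R(n := rval T (I, R) e)), m + rcost e))"
| "exec T (Seq p q) c = exec T q (exec T p c)"
| "exec T (Repeat e p) c =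
     (case c of ((I, R), m) \<Rightarrow>
       ((\<lambda>(s, m'). exec T p (s, m' + 1)) ^^ nat (ival I e)) ((I, R), m + icost e))"

text \<open>On input, integer registers 0 and 1 hold \<open>\<psi>\<close> and \<open>k\<close>, real register 0 holds the weight and
  all other registers are zero. The new weight is read off from real register 0.\<close>

definition run :: "(int \<Rightarrow> real) \<Rightarrow> prog \<Rightarrow> nat \<Rightarrow> nat \<Rightarrow> real \<Rightarrow> state \<times> nat"
  where "run T p \<psi> k x =
    exec T p (((\<lambda>_. 0)(0 := int \<psi>, 1 := int k), (\<lambda>_. 0)(0 := x)), 0)"

definition new_weight :: "(int \<Rightarrow> real) \<Rightarrow> prog \<Rightarrow> nat \<Rightarrow> nat \<Rightarrow> real \<Rightarrow> real"
  where "new_weight T p \<psi> k x = snd (fst (run T p \<psi> k x)) 0"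

definition run_cost :: "(int \<Rightarrow> real) \<Rightarrow> prog \<Rightarrow> nat \<Rightarrow> nat \<Rightarrow> real \<Rightarrow> nat"
  where "run_cost T p \<psi> k x = snd (run T p \<psi> k x)"

end

theory Submission
  imports Defs
begin

text \<open>Each update multiplies the weight by \<open>1 / (1 + \<eta> t * lam2)\<close>, and
  \<open>\<Phi>\<close> is the running product of these factors. In the quotient of two of its
  values the factors before \<psi> cancel, leaving exactly those of the pending updates;
  \<open>lazy_weight\<close> makes this precise by induction on the final iteration. The cost bound
  follows because the quotient needs only two stored values: the single loop-free program
  \<open>lazy_prog\<close> evaluates it for every input.\<close>

lemma Phi_minus_one: "\<Phi> lam2 \<eta> (-1) = 1"
  by (simp add: \<Phi>.simps)

lemma Phi_of_nat:
  "\<Phi> lam2 \<eta> (int t) = \<Phi> lam2 \<eta> (int t - 1) / (1 + \<eta> t * lam2)"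
  by (subst \<Phi>.simps) (simp add: divide_inverse mult.commute)

text \<open>Every factor has denominator at least 1. The shift \<open>int n - 1\<close> lets
  induction on naturals start at the index -1.\<close>

lemma Phi_pos:
  assumes "0 \<le> lam2" and "\<And>t. 0 < \<eta> t"
  shows "0 < \<Phi> lam2 \<eta> (int n - 1)"
proof (induction n)
  case 0
  show ?case by (simp add: Phi_minus_one)
next
  case (Suc n)
  have "0 < 1 + \<eta> n * lam2"
    using assms by (simp add: add_pos_nonneg less_imp_le)
  with Suc show ?case by (simp add: Phi_of_nat)
qed

lemma lazy_weight:
  assumes "fobos_l2sq_setting lam2 \<eta> w \<psi> k"
  shows "w k = w \<psi> * (\<Phi> lam2 \<eta> (int k - 1) / \<Phi> lam2 \<eta> (int \<psi> - 1))"
proof -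
  have pos: "0 < \<Phi> lam2 \<eta> (int n - 1)" for n
    using assms by (intro Phi_pos) (auto simp: fobos_l2sq_setting_def)
  have update: "w (Suc t) = w t / (1 + \<eta> t * lam2)" if "\<psi> \<le> t" "t < k" for t
    using assms that by (simp add: fobos_l2sq_setting_def fobos_l2sq_update_def)
  have "\<psi> \<le> k"
    using assms by (simp add: fobos_l2sq_setting_def)
  then show ?thesis
  proof (induction rule: dec_induct)
    case base
    \<comment> \<open>The quotient is 1 only because its denominator is nonzero: division by zero
      yields 0 in HOL.\<close>
    show ?case using pos[of \<psi>] by simp
  next
    case (step n)
    \<comment> \<open>Passing from \<open>n\<close> to \<open>Suc n\<close> divides both the weight
      and the numerator by \<open>1 + \<eta> n * lam2\<close>.\<close>
    then show ?case by (simp add: update Phi_of_nat)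
  qed
qed

definition lazy_prog :: prog
  where "lazy_prog = RSet 0 (RMul (RReg 0)
    (RDiv (Lookup (ISub (IReg 1) (ILit 1))) (Lookup (ISub (IReg 0) (ILit 1)))))"

lemma new_weight_lazy_prog:
  "new_weight T lazy_prog \<psi> k x = x * (T (int k - 1) / T (int \<psi> - 1))"
  by (simp add: new_weight_def run_def lazy_prog_def)

text \<open>Two index subtractions, two lookups, one division and one multiplication.\<close>

lemma run_cost_lazy_prog: "run_cost T lazy_prog \<psi> k x = 6"
  by (simp add: run_cost_def run_def lazy_prog_def)

theorem mainTheorem4:
  "(\<forall>(lam2::real) (\<eta>::nat \<Rightarrow> real) (w::nat \<Rightarrow> real) (\<psi>::nat) (k::nat).
      fobos_l2sq_setting lam2 \<eta> w \<psi> k \<longrightarrow>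
        \<Phi> lam2 \<eta> 0 = 1 / (1 + \<eta> 0 * lam2) \<and>
        w k = w \<psi> * (\<Phi> lam2 \<eta> (int k - 1) / \<Phi> lam2 \<eta> (int \<psi> - 1))) \<and>
   (\<exists>(p::prog) (C::nat).
      \<forall>(lam2::real) (\<eta>::nat \<Rightarrow> real) (w::nat \<Rightarrow> real) (\<psi>::nat) (k::nat) (T::int \<Rightarrow> real).
        fobos_l2sq_setting lam2 \<eta> w \<psi> k \<and>
        (\<forall>t. -1 \<le> t \<and> t \<le> int k - 1 \<longrightarrow> T t = \<Phi> lam2 \<eta> t) \<longrightarrow>
          new_weight T p \<psi> k (w \<psi>) = w k \<and> run_cost T p \<psi> k (w \<psi>) \<le> C)"
proof (intro conjI allI impI exI[of _ lazy_prog] exI[of _ 6])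
  fix lam2 :: real and \<eta> w :: "nat \<Rightarrow> real" and \<psi> k :: nat
  assume setting: "fobos_l2sq_setting lam2 \<eta> w \<psi> k"
  show "\<Phi> lam2 \<eta> 0 = 1 / (1 + \<eta> 0 * lam2)"
    using Phi_of_nat[of lam2 \<eta> 0] by (simp add: Phi_minus_one)
  show "w k = w \<psi> * (\<Phi> lam2 \<eta> (int k - 1) / \<Phi> lam2 \<eta> (int \<psi> - 1))"
    using setting by (rule lazy_weight)
next
  fix lam2 :: real and \<eta> w :: "nat \<Rightarrow> real" and \<psi> k :: nat and T :: "int \<Rightarrow> real"
  assume asm: "fobos_l2sq_setting lam2 \<eta> w \<psi> k \<and>
    (\<forall>t. -1 \<le> t \<and> t \<le> int k - 1 \<longrightarrow> T t = \<Phi> lam2 \<eta> t)"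
  \<comment> \<open>This keeps the lookup at \<open>int \<psi> - 1\<close> within the range where
    \<open>T\<close> agrees with \<open>\<Phi>\<close>; for \<psi> = 0 it reads the entry at
    -1.\<close>
  then have "\<psi> \<le> k"
    by (simp add: fobos_l2sq_setting_def)
  with asm show "new_weight T lazy_prog \<psi> k (w \<psi>) = w k"
    using lazy_weight[of lam2 \<eta> w \<psi> k] by (simp add: new_weight_lazy_prog)
  show "run_cost T lazy_prog \<psi> k (w \<psi>) \<le> 6"
    by (simp add: run_cost_lazy_prog)
qed

end
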